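(* Let $d\ge 1$, $f\ge 0$ be integers, let $\epsilon>0$ and $\mu\le U$ be reals, and let $G(\mathcal{V},\mathcal{E})$ be a simple directed graph without self-loops on $n=|\mathcal{V}|\ge 2$ processes that satisfies Condition SC: for every partition $F,L,C,R$ of $\mathcal{V}$ such that $L$ and $R$ are both non-empty and $|F|\le f$ (with $F$, $C$ possibly empty), either some process in $L$ has at least $df+1$ incoming edges from processes in $R\cup C$, or some process in $R$ has at least $df+1$ incoming edges from processes in $L\cup C$. Then Algorithm Byz-Iter satisfies the termination, validity and $\epsilon$-agreement conditions in $G$; that is, for every set $\mathcal{F}\subset\mathcal{V}$ of at most $f$ faulty processes, every behavior of the faulty processes, every choice of Tverberg points made by the algorithm, and all inputs $\mathbf{v}_i[0]\in[\mu,U]^d$ of the fault-free processes $i\in\mathcal{V}-\mathcal{F}$: (Termination) each fault-free process terminates after a finite number of iterations; (Validity) the state of each fault-free process at the end of each iteration is in the convex hull of the input vectors of the fault-free processes; ($\epsilon$-Agreement) at termination, for each $1\le l\le d$, the $l$-th elements of the decision vectors (final states) of any two fault-free processes are within $\epsilon$ of each other.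
   Context: System model. $\mathcal{V}=\{1,\dots,n\}$; process $i$ can reliably send messages to $j\neq i$ iff $(i,j)\in\mathcal{E}$; $N_i^-=\{j:(j,i)\in\mathcal{E}\}$. The system is synchronous. Faulty (Byzantine) processes behave arbitrarily, may collude with complete knowledge of the execution, and may send arbitrary, different points of $\mathbf{R}^d$ to different neighbors in each iteration. The constants $\mu,U$ bound the elements of the inputs of fault-free processes from below and above and are known a priori. Tverberg point. For a multiset $Y$ of $(d+1)f+1$ points of $\mathbf{R}^d$, a Tverberg point of $Y$ is a point of $\bigcap_{l=1}^{f+1}\mathcal{H}(Y_l)$ for some partition $Y_1,\dots,Y_{f+1}$ of $Y$ into $f+1$ non-empty multisets, where $\mathcal{H}$ denotes convex hull (such a point exists by Tverberg's theorem). Algorithm Byz-Iter. Each process $i$ has state $\mathbf{v}_i\in\mathbf{R}^d$, with $\mathbf{v}_i[0]$ its input and $\mathbf{v}_i[t]$ its state at the end of iteration $t$. In iteration $t\ge 1$ each fault-free process $i$: 1. transmits $\mathbf{v}_i[t-1]$ on all outgoing edges; 2. receives values on all incoming edges (a missing message is taken to be the zero vector), forming a multiset $r_i[t]$ of size $|N_i^-|$; 3. forms a multiset $Z_i[t]$ containing, for each sub-multiset $C\subseteq r_i[t]$ with $|C|=(d+1)f+1$ (so there are $\binom{|r_i[t]|}{(d+1)f+1}$ of them, counted with multiplicity), any one Tverberg point of $C$, and sets $$\mathbf{v}_i[t]=\frac{\mathbf{v}_i[t-1]+\sum_{\mathbf{z}\in Z_i[t]}\mathbf{z}}{1+|Z_i[t]|}.$$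 Each fault-free process terminates after $t_{end}$ iterations and decides on its state. Definition of $t_{end}$. For $F\subset\mathcal{V}$ (proper subset) with $|F|\le f$, a reduced graph corresponding to $F$ is a graph with vertex set $\mathcal{V}-F$ obtained from $G$ by removing all links incident on processes in $F$ and then removing up to $df$ additional incoming links at each process in $\mathcal{V}-F$; $R_F$ is the set of all of them, and $r=\max_{|F|\le f}|R_F|$. Let $\beta=\frac1n$ if $f=0$ and $\beta=\frac{1}{n^2\left(1+\binom{n}{(d+1)f+1}\right)}$ if $f>0$. Then $t_{end}$ is the smallest positive integer $t$ with $$\left(1-\beta^{rn}\right)^{\lfloor t/(rn)\rfloor}<\frac{\epsilon}{n\max(|U|,|\mu|)},$$ where the right-hand side is read as $+\infty$ if $U=\mu=0$. *)

theory Defs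
  imports "HOL-Analysis.Analysis" "HOL-Library.Multiset"
begin

text \<open>
  The processes are the elements of \<open>{1..n}\<close>, the communication graph is a set \<open>E\<close> of pairs
  with \<open>(j, i) \<in> E\<close> meaning that \<open>j\<close> can send to \<open>i\<close>. Points live in \<open>real ^ 'd\<close>, so the
  dimension is \<open>d = CARD('d)\<close>.
\<close>

definition simple_digraph :: "nat \<Rightarrow> (nat \<times> nat) set \<Rightarrow> bool" where
  "simple_digraph n E \<longleftrightarrow> E \<subseteq> {1..n} \<times> {1..n} \<and> irrefl E"

definition in_nbrs :: "(nat \<times> nat) set \<Rightarrow> nat \<Rightarrow> nat set" where
  "in_nbrs E i = {j. (j, i) \<in> E}"

definition condition_SC :: "nat \<Rightarrow> nat \<Rightarrow> nat \<Rightarrow> (nat \<times> nat) set \<Rightarrow> bool" where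
  "condition_SC d f n E \<longleftrightarrow>
    (\<forall>F L C R.
       F \<union> L \<union> C \<union> R = {1..n} \<and>
       F \<inter> L = {} \<and> F \<inter> C = {} \<and> F \<inter> R = {} \<and> L \<inter> C = {} \<and> L \<inter> R = {} \<and> C \<inter> R = {} \<and>
       L \<noteq> {} \<and> R \<noteq> {} \<and> card F \<le> f \<longrightarrow>
       (\<exists>i\<in>L. card (in_nbrs E i \<inter> (R \<union> C)) \<ge> d * f + 1) \<or>
       (\<exists>i\<in>R. card (in_nbrs E i \<inter> (L \<union> C)) \<ge> d * f + 1))"

definition tverberg_point :: "nat \<Rightarrow> (real ^ 'd) multiset \<Rightarrow> real ^ 'd \<Rightarrow> bool" where
  "tverberg_point f Y x \<longleftrightarrow>
     size Y = (CARD('d) + 1) * f + 1 \<and>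
     (\<exists>P :: nat \<Rightarrow> (real ^ 'd) multiset.
        (\<forall>l\<in>{1..f+1}. P l \<noteq> {#}) \<and> (\<Sum>l\<in>{1..f+1}. P l) = Y \<and>
        x \<in> (\<Inter>l\<in>{1..f+1}. convex hull (set_mset (P l))))"

text \<open>
  A reduced graph for \<open>F\<close> has vertex set \<open>{1..n} - F\<close>; it is represented by its set \<open>H\<close> of links.
\<close>

definition reduced_graphs ::
    "nat \<Rightarrow> nat \<Rightarrow> nat \<Rightarrow> (nat \<times> nat) set \<Rightarrow> nat set \<Rightarrow> (nat \<times> nat) set set" where
  "reduced_graphs d f n E F =
     (let E' = E \<inter> (({1..n} - F) \<times> ({1..n} - F))
      in {H. H \<subseteq> E' \<and> (\<forall>i\<in>{1..n} - F. card (in_nbrs (E' - H) i) \<le> d * f)})"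

definition max_reduced :: "nat \<Rightarrow> nat \<Rightarrow> nat \<Rightarrow> (nat \<times> nat) set \<Rightarrow> nat" where
  "max_reduced d f n E = Max {card (reduced_graphs d f n E F) | F. F \<subset> {1..n} \<and> card F \<le> f}"

definition beta :: "nat \<Rightarrow> nat \<Rightarrow> nat \<Rightarrow> real" where
  "beta d f n =
     (if f = 0 then 1 / real n
      else 1 / (real n ^ 2 * (1 + real (n choose ((d + 1) * f + 1)))))"

text \<open>
  The disjunct \<open>U = 0 \<and> \<mu> = 0\<close> is the convention that the right-hand side is then infinite
  (in HOL the quotient would be 0).
\<close>

definition stop_cond ::
    "nat \<Rightarrow> nat \<Rightarrow> nat \<Rightarrow> (nat \<times> nat) set \<Rightarrow> real \<Rightarrow> real \<Rightarrow> real \<Rightarrow> nat \<Rightarrow> bool" where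
  "stop_cond d f n E \<epsilon> \<mu> U t \<longleftrightarrow>
     (let rn = max_reduced d f n E * n
      in (U = 0 \<and> \<mu> = 0) \<or>
         (1 - beta d f n ^ rn) ^ (t div rn) < \<epsilon> / (real n * max \<bar>U\<bar> \<bar>\<mu>\<bar>))"

text \<open>
  A predicate rather than a \<open>LEAST\<close> term, so that existence of \<open>t_end\<close> is not presupposed.
\<close>

definition is_t_end ::
    "nat \<Rightarrow> nat \<Rightarrow> nat \<Rightarrow> (nat \<times> nat) set \<Rightarrow> real \<Rightarrow> real \<Rightarrow> real \<Rightarrow> nat \<Rightarrow> bool" where
  "is_t_end d f n E \<epsilon> \<mu> U t \<longleftrightarrow>
     0 < t \<and> stop_cond d f n E \<epsilon> \<mu> U t \<and> (\<forall>s. 0 < s \<and> s < t \<longrightarrow> \<not> stop_cond d f n E \<epsilon> \<mu> U s)"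

text \<open>
  Update of a process with in-neighbours \<open>N\<close> and previous state \<open>x\<close>, which received \<open>rcv j\<close> from
  \<open>j \<in> N\<close>. The received multiset is indexed by \<open>N\<close>, so its sub-multisets of a given size,
  counted with multiplicity, correspond to the subsets \<open>S\<close> of \<open>N\<close> of that size; \<open>z S\<close> is the
  Tverberg point chosen for \<open>S\<close>.
\<close>

definition byz_iter_update ::
    "nat \<Rightarrow> nat set \<Rightarrow> (nat \<Rightarrow> real ^ 'd) \<Rightarrow> real ^ 'd \<Rightarrow> real ^ 'd \<Rightarrow> bool" where
  "byz_iter_update f N rcv x y \<longleftrightarrow>
     (let \<S> = {S. S \<subseteq> N \<and> card S = (CARD('d) + 1) * f + 1}
      in \<exists>z. (\<forall>S\<in>\<S>. tverberg_point f (image_mset rcv (mset_set S)) (z S)) \<and>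
             (let Z = image_mset z (mset_set \<S>)
              in y = (x + sum_mset Z) /\<^sub>R (1 + real (size Z))))"

text \<open>
  \<open>v i t\<close> is the state of \<open>i\<close> at the end of iteration \<open>t\<close>, \<open>halted i t\<close> says that \<open>i\<close> has
  terminated by then, and \<open>msg t j i\<close> is what \<open>j\<close> sends to \<open>i\<close> in iteration \<open>t\<close> (\<open>None\<close> if
  nothing). Only processes outside the faulty set \<open>B\<close> are constrained; a halted process is inert,
  so its state from then on is its decision.
\<close>

definition byz_iter_execution ::
    "nat \<Rightarrow> nat \<Rightarrow> (nat \<times> nat) set \<Rightarrow> real \<Rightarrow> real \<Rightarrow> real \<Rightarrow> nat set \<Rightarrow>
     (nat \<Rightarrow> nat \<Rightarrow> nat \<Rightarrow> (real ^ 'd) option) \<Rightarrow> (nat \<Rightarrow> nat \<Rightarrow> real ^ 'd) \<Rightarrow>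
     (nat \<Rightarrow> nat \<Rightarrow> bool) \<Rightarrow> bool" where
  "byz_iter_execution f n E \<epsilon> \<mu> U B msg v halted \<longleftrightarrow>
     (\<forall>i\<in>{1..n} - B.
        \<not> halted i 0 \<and>
        (\<forall>t\<ge>1.
           if halted i (t - 1) then
             halted i t \<and> v i t = v i (t - 1) \<and> (\<forall>k. msg t i k = None)
           else
             (\<forall>k. (i, k) \<in> E \<longrightarrow> msg t i k = Some (v i (t - 1))) \<and>
             byz_iter_update f (in_nbrs E i)
               (\<lambda>j. case msg t j i of None \<Rightarrow> 0 | Some x \<Rightarrow> x) (v i (t - 1)) (v i t) \<and>
             (halted i t \<longleftrightarrow> is_t_end CARD('d) f n E \<epsilon> \<mu> U t)))"

definition termination_cond :: "nat set \<Rightarrow> (nat \<Rightarrow> nat \<Rightarrow> bool) \<Rightarrow> bool" where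
  "termination_cond A halted \<longleftrightarrow> (\<forall>i\<in>A. \<exists>t. halted i t)"

definition validity_cond :: "nat set \<Rightarrow> (nat \<Rightarrow> nat \<Rightarrow> real ^ 'd) \<Rightarrow> bool" where
  "validity_cond A v \<longleftrightarrow> (\<forall>i\<in>A. \<forall>t. v i t \<in> convex hull ((\<lambda>j. v j 0) ` A))"

definition agreement_cond ::
    "real \<Rightarrow> nat set \<Rightarrow> (nat \<Rightarrow> nat \<Rightarrow> real ^ 'd) \<Rightarrow> (nat \<Rightarrow> nat \<Rightarrow> bool) \<Rightarrow> bool" where
  "agreement_cond \<epsilon> A v halted \<longleftrightarrow>
     (\<forall>i\<in>A. \<forall>j\<in>A. \<forall>s t. halted i s \<and> halted j t \<longrightarrow> (\<forall>l. \<bar>v i s $ l - v j t $ l\<bar> \<le> \<epsilon>))"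

end

theory Submission
  imports Defs
begin

text \<open>
  No transition matrices are needed. Among the \<open>f + 1\<close> disjoint parts behind a Tverberg point of
  values indexed by \<open>S\<close>, some part avoids any given \<open>f\<close> indices; hence the Tverberg point lies in
  the convex hull of the values with indices in \<open>X\<close> whenever \<open>card (S - X) \<le> f\<close>. With \<open>X\<close> the
  fault-free processes this gives validity. With \<open>X\<close> consisting of \<open>d * f + 1\<close> fault-free
  in-neighbours whose \<open>l\<close>-th elements are at least \<open>\<theta>\<close>, it shows that one of the averaged points
  is at least \<open>\<theta>\<close>, so the new state exceeds the current minimum \<open>m\<close> by at least \<open>\<beta> (\<theta> - m)\<close>.

  For agreement, let \<open>D\<close> be the spread \<open>M - m\<close> of the \<open>l\<close>-th elements, and call a process high
  (low) after \<open>k\<close> further iterations if it is at least \<open>m + \<beta>^k D / 2\<close> (at most \<open>M - \<beta>^k D / 2\<close>).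
  Every process is high or low and stays so. As long as some process is not high and some
  process is not low, Condition SC applied to these two groups makes a low process high as well, or
  conversely. So after \<open>n - 1\<close> iterations all are high or all are low, and the spread has shrunk by
  the factor \<open>1 - \<beta>^(n - 1) / 2 \<le> 1 - \<beta>^n\<close>.
\<close>

section \<open>Tverberg points and convexity of one update\<close>

lemma tverberg_point_in_hull:
  assumes tv: "tverberg_point f (image_mset g (mset_set S)) z"
    and fin: "finite S" and X: "card (S - X) \<le> f"
  shows "z \<in> convex hull (g ` (S \<inter> X))"
proof -
  let ?Y = "image_mset g (mset_set S)"
  \<comment> \<open>Indices may share values, so the bad elements are those whose value no index in
    \<open>S \<inter> X\<close> attains. At most \<open>card (S - X)\<close> indices carry one, too
    few to meet all \<open>f + 1\<close> parts.\<close>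
  let ?Q = "\<lambda>y. y \<notin> g ` (S \<inter> X)"
  obtain P where ne: "\<forall>l\<in>{1..f+1}. P l \<noteq> {#}" and sum: "(\<Sum>l\<in>{1..f+1}. P l) = ?Y"
    and z: "\<forall>l\<in>{1..f+1}. z \<in> convex hull (set_mset (P l))"
    using tv unfolding tverberg_point_def by auto
  have "\<exists>l\<in>{1..f+1}. filter_mset ?Q (P l) = {#}"
  proof (rule ccontr)
    assume "\<not> ?thesis"
    then have "\<And>l. l \<in> {1..f+1} \<Longrightarrow> 1 \<le> size (filter_mset ?Q (P l))"
      by (metis One_nat_def Suc_leI nonempty_has_size)
    then have "(\<Sum>l\<in>{1..f+1}. 1) \<le> (\<Sum>l\<in>{1..f+1}. size (filter_mset ?Q (P l)))"
      by (rule sum_mono)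
    moreover have "(\<Sum>l\<in>I. size (filter_mset ?Q (P l))) = size (filter_mset ?Q (\<Sum>l\<in>I. P l))"
      if "finite I" for I
      using that by (induction I) auto
    ultimately have "(\<Sum>l\<in>{1..f+1}. 1) \<le> size (filter_mset ?Q (\<Sum>l\<in>{1..f+1}. P l))"
      by (metis finite_atLeastAtMost)
    then have "f + 1 \<le> size (filter_mset ?Q ?Y)"
      unfolding sum by simp
    also have "\<dots> = card {i \<in> S. ?Q (g i)}"
      using fin by (simp add: filter_mset_image_mset)
    also have "\<dots> \<le> card (S - X)"
      using fin by (intro card_mono) auto
    finally show False using X by simp
  qed
  then obtain l where l: "l \<in> {1..f+1}" "filter_mset ?Q (P l) = {#}" by blast
  then have "set_mset (P l) \<subseteq> g ` (S \<inter> X)"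
    by (auto simp: filter_mset_eq_conv)
  then show ?thesis
    using z l(1) hull_mono by blast
qed

lemma byz_iter_updateE:
  fixes x y :: "real ^ 'd"
  assumes "byz_iter_update f N rcv x y"
  obtains z where
    "\<forall>S\<in>{S. S \<subseteq> N \<and> card S = (CARD('d) + 1) * f + 1}.
       tverberg_point f (image_mset rcv (mset_set S)) (z S)"
    "y = (x + sum z {S. S \<subseteq> N \<and> card S = (CARD('d) + 1) * f + 1}) /\<^sub>R
         (1 + real (card {S. S \<subseteq> N \<and> card S = (CARD('d) + 1) * f + 1}))"
  using assms unfolding byz_iter_update_def Let_def
  by (auto simp: sum_unfold_sum_mset)

text \<open>Taking \<open>- B\<close> as the trusted indices puts every Tverberg point in
  \<open>K\<close>, and the new state averages these points with \<open>x\<close>.\<close>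

lemma byz_iter_update_in_convex:
  fixes x y :: "real ^ 'd"
  assumes up: "byz_iter_update f N rcv x y" and fin: "finite N" "finite B" and B: "card B \<le> f"
    and K: "convex K" "x \<in> K" "rcv ` (N - B) \<subseteq> K"
  shows "y \<in> K"
proof -
  let ?SS = "{S. S \<subseteq> N \<and> card S = (CARD('d) + 1) * f + 1}"
  obtain z where tv: "\<forall>S\<in>?SS. tverberg_point f (image_mset rcv (mset_set S)) (z S)"
    and y: "y = (x + sum z ?SS) /\<^sub>R (1 + real (card ?SS))"
    using byz_iter_updateE[OF up] by blast
  have finSS: "finite ?SS" using fin by simp
  have zK: "z S \<in> K" if S: "S \<in> ?SS" for S
  proof -
    have "S - - B \<subseteq> B" by auto
    then have "card (S - - B) \<le> f"
      using B fin(2) card_mono le_trans by blast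
    moreover have "finite S" using S fin finite_subset by auto
    ultimately have "z S \<in> convex hull (rcv ` (S \<inter> - B))"
      using tverberg_point_in_hull tv S by blast
    also have "\<dots> \<subseteq> K"
      using K S by (intro hull_minimal) auto
    finally show ?thesis .
  qed
  \<comment> \<open>\<open>None\<close> indexes the old state, so that the average becomes a single
    convex combination with equal weights.\<close>
  let ?h = "\<lambda>u. case u of None \<Rightarrow> x | Some S \<Rightarrow> z S"
  let ?I = "insert None (Some ` ?SS)"
  have cI: "card ?I = 1 + card ?SS"
    using finSS by (simp add: card_image)
  have "(\<Sum>u\<in>?I. (1 / real (card ?I)) *\<^sub>R ?h u) \<in> K"
    using K finSS zK by (intro convex_sum) (auto simp del: card_insert_disjoint)
  moreover have "(\<Sum>u\<in>?I. ?h u) = x + sum z ?SS"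
    using finSS by (simp add: sum.reindex)
  ultimately show ?thesis
    unfolding y scaleR_sum_right[symmetric] cI by (simp add: inverse_eq_divide)
qed

section \<open>Weights and the gain of one update\<close>

lemma beta_pos: "n > 0 \<Longrightarrow> 0 < beta d f n"
  by (auto simp: beta_def intro!: divide_pos_pos mult_pos_pos add_pos_nonneg)

lemma beta_le_half:
  assumes "n \<ge> 2" shows "beta d f n \<le> 1 / 2"
proof -
  have "2 * (1 * 1) \<le> real n * (real n * (1 + real (n choose ((d + 1) * f + 1))))"
    using assms by (intro mult_mono) auto
  then have "2 \<le> real n ^ 2 * (1 + real (n choose ((d + 1) * f + 1)))"
    unfolding power2_eq_square mult.assoc by simp
  then show ?thesis
    using assms by (auto simp: beta_def intro!: frac_le)
qed

text \<open>\<open>beta\<close> is a uniform lower bound for the weight of an averaged point. If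
  \<open>f = 0\<close> the subsets are singletons, at most \<open>n - 1\<close> of them; otherwise
  their number is a binomial coefficient, monotone in \<open>card N\<close>.\<close>

lemma beta_le_weight:
  assumes "finite N" "card N < n"
  shows "beta d f n \<le> 1 / (1 + real (card {S. S \<subseteq> N \<and> card S = (d + 1) * f + 1}))"
proof (cases "f = 0")
  case True
  then show ?thesis
    using assms n_subsets[OF assms(1), of 1] by (auto simp: beta_def intro!: frac_le)
next
  case False
  let ?k = "(d + 1) * f + 1"
  have "card {S. S \<subseteq> N \<and> card S = ?k} \<le> n choose ?k"
    unfolding n_subsets[OF assms(1)] using assms(2) by (intro binomial_right_mono) simp
  then have "1 * (1 + real (card {S. S \<subseteq> N \<and> card S = ?k})) \<le> (real n)\<^sup>2 * (1 + real (n choose ?k))"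
    using assms(2) by (intro mult_mono one_le_power) auto
  then show ?thesis
    using False by (auto simp: beta_def intro!: frac_le)
qed

text \<open>All averaged points are at least \<open>m\<close> in direction \<open>a\<close>, and one
  of them, \<open>x\<close> or a suitable Tverberg point, is at least \<open>\<theta>\<close>. A
  general direction serves lower and upper bounds alike.\<close>

lemma byz_iter_update_lift:
  fixes x y :: "real ^ 'd"
  assumes up: "byz_iter_update f N rcv x y" and fin: "finite N" "finite B" and B: "card B \<le> f"
    and N: "card N < n" "f > 0 \<Longrightarrow> (CARD('d) + 1) * f + 1 \<le> card N"
    and m: "m \<le> \<theta>" "m \<le> a \<bullet> x" "\<forall>j\<in>N - B. m \<le> a \<bullet> rcv j"
    and \<theta>: "\<theta> \<le> a \<bullet> x \<or> CARD('d) * f + 1 \<le> card {j \<in> N - B. \<theta> \<le> a \<bullet> rcv j}"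
  shows "m + beta CARD('d) f n * (\<theta> - m) \<le> a \<bullet> y"
proof -
  let ?k = "(CARD('d) + 1) * f + 1"
  let ?SS = "{S. S \<subseteq> N \<and> card S = ?k}"
  obtain z where tv: "\<forall>S\<in>?SS. tverberg_point f (image_mset rcv (mset_set S)) (z S)"
    and y: "y = (x + sum z ?SS) /\<^sub>R (1 + real (card ?SS))"
    using byz_iter_updateE[OF up] by blast
  have finSS: "finite ?SS" using fin by simp
  have halfspace: "c \<le> a \<bullet> z S"
    if S: "S \<in> ?SS" and X: "card (S - X) \<le> f" and c: "\<forall>j\<in>S \<inter> X. c \<le> a \<bullet> rcv j" for S X c
  proof -
    have "finite S" using S fin finite_subset by auto
    then have "z S \<in> convex hull (rcv ` (S \<inter> X))"
      using tverberg_point_in_hull tv S X by blast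
    also have "\<dots> \<subseteq> {w. c \<le> a \<bullet> w}"
      using c by (intro hull_minimal) (auto simp: convex_halfspace_ge)
    finally show ?thesis by simp
  qed
  have low: "m \<le> a \<bullet> z S" if "S \<in> ?SS" for S
  proof (rule halfspace[OF that, of "- B"])
    have "S - - B \<subseteq> B" by auto
    then show "card (S - - B) \<le> f"
      using B fin(2) card_mono le_trans by blast
    show "\<forall>j\<in>S \<inter> - B. m \<le> a \<bullet> rcv j" using m(3) that by auto
  qed
  have "\<theta> - m \<le> (a \<bullet> x - m) + (\<Sum>S\<in>?SS. a \<bullet> z S - m)"
    using \<theta>
  proof
    assume "\<theta> \<le> a \<bullet> x"
    moreover have "0 \<le> (\<Sum>S\<in>?SS. a \<bullet> z S - m)"
      using low by (intro sum_nonneg) simp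
    ultimately show ?thesis by linarith
  next
    assume hi: "CARD('d) * f + 1 \<le> card {j \<in> N - B. \<theta> \<le> a \<bullet> rcv j}"
    then obtain X where X: "X \<subseteq> {j \<in> N - B. \<theta> \<le> a \<bullet> rcv j}" "card X = CARD('d) * f + 1"
      "finite X"
      by (meson obtain_subset_with_card_n)
    have XN: "X \<subseteq> N" using X by auto
    then have "CARD('d) * f + 1 \<le> card N"
      using X(2) card_mono[OF fin(1)] by metis
    then have "?k \<le> card N"
      using N(2) by (cases "f = 0") auto
    then have "f \<le> card (N - X)"
      using X fin XN by (simp add: card_Diff_subset)
    \<comment> \<open>The high in-neighbours in \<open>X\<close> are padded with \<open>f\<close>
      arbitrary ones, possibly faulty, to reach the size \<open>?k\<close>; the Tverberg point still
      lies in the hull of the values on \<open>X\<close>.\<close>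
    then obtain W where W: "W \<subseteq> N - X" "card W = f" "finite W"
      by (meson obtain_subset_with_card_n)
    have S: "X \<union> W \<in> ?SS"
      using W X XN by (subst mem_Collect_eq, subst card_Un_disjoint) auto
    have "\<theta> \<le> a \<bullet> z (X \<union> W)"
    proof (rule halfspace[OF S, of X])
      have "X \<union> W - X = W" using W by auto
      then show "card (X \<union> W - X) \<le> f" using W by simp
    qed (use X in auto)
    moreover have "a \<bullet> z (X \<union> W) - m \<le> (\<Sum>S\<in>?SS. a \<bullet> z S - m)"
      using low finSS S by (intro member_le_sum) auto
    ultimately show ?thesis using m(2) by linarith
  qed
  also have "\<dots> = (a \<bullet> y - m) * (1 + real (card ?SS))"
  proof -
    define c where "c = 1 + real (card ?SS)"
    have "a \<bullet> y * c = a \<bullet> x + (\<Sum>S\<in>?SS. a \<bullet> z S)"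
      unfolding y c_def[symmetric] inner_scaleR_right inner_add_right inner_sum_right
      by (simp add: c_def)
    then show ?thesis
      unfolding c_def[symmetric] by (simp add: sum_subtractf left_diff_distrib c_def distrib_left)
  qed
  finally have "(\<theta> - m) / (1 + real (card ?SS)) \<le> a \<bullet> y - m"
    by (subst pos_divide_le_eq) auto
  moreover have "beta CARD('d) f n * (\<theta> - m) \<le> 1 / (1 + real (card ?SS)) * (\<theta> - m)"
    using m(1) by (intro mult_right_mono beta_le_weight fin N) auto
  ultimately show ?thesis by simp
qed

section \<open>Contraction of the spread\<close>

text \<open>
  The only facts about one iteration that agreement uses, stated for lower bounds; upper bounds are
  obtained by negating \<open>x\<close> and \<open>x'\<close>.
\<close>

definition lifts ::
    "nat \<Rightarrow> real \<Rightarrow> 'i set \<Rightarrow> ('i \<Rightarrow> 'i set) \<Rightarrow> ('i \<Rightarrow> real) \<Rightarrow> ('i \<Rightarrow> real) \<Rightarrow> bool" where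
  "lifts k b A N x x' \<longleftrightarrow>
     (\<forall>i\<in>A. \<forall>m \<theta>. m \<le> \<theta> \<and> (\<forall>j\<in>A. m \<le> x j) \<and> (\<theta> \<le> x i \<or> k \<le> card {j \<in> N i \<inter> A. \<theta> \<le> x j}) \<longrightarrow>
        m + b * (\<theta> - m) \<le> x' i)"

lemma liftsD:
  assumes "lifts k b A N x x'" "i \<in> A" "m \<le> \<theta>" "\<forall>j\<in>A. m \<le> x j"
    "\<theta> \<le> x i \<or> k \<le> card {j \<in> N i \<inter> A. \<theta> \<le> x j}"
  shows "m + b * (\<theta> - m) \<le> x' i"
  using assms unfolding lifts_def by blast

text \<open>The case \<open>\<theta> = m\<close> of \<open>lifts\<close> preserves a common lower
  bound in each iteration.\<close>

lemma lifts_lower_bound: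
  assumes "\<forall>t<T. lifts k b A N (x t) (x (Suc t))" "\<forall>i\<in>A. m \<le> x s i" "s \<le> t" "t \<le> T"
  shows "\<forall>i\<in>A. m \<le> x t i"
  using assms(3,4)
proof (induction rule: dec_induct)
  case base
  then show ?case using assms(2) by simp
next
  case (step t)
  then have "lifts k b A N (x t) (x (Suc t))" "\<forall>i\<in>A. m \<le> x t i"
    using assms(1) by auto
  then show ?case using liftsD[where m = m and \<theta> = m] by fastforce
qed

lemma lifts_spread_contracts:
  fixes x :: "nat \<Rightarrow> 'i \<Rightarrow> real"
  assumes fin: "finite A" "card A \<le> n" "n > 0" and b: "0 < b" "b \<le> 1 / 2"
    and up: "\<forall>t<T. lifts k b A N (x t) (x (Suc t))"
    and down: "\<forall>t<T. lifts k b A N (\<lambda>i. - x t i) (\<lambda>i. - x (Suc t) i)"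
    and SC: "\<And>L R. L \<subseteq> A \<Longrightarrow> R \<subseteq> A \<Longrightarrow> L \<inter> R = {} \<Longrightarrow> L \<noteq> {} \<Longrightarrow> R \<noteq> {} \<Longrightarrow>
      (\<exists>i\<in>L. k \<le> card (N i \<inter> (A - L))) \<or> (\<exists>i\<in>R. k \<le> card (N i \<inter> (A - R)))"
    and bounds: "m \<le> M" "\<forall>i\<in>A. m \<le> x s i \<and> x s i \<le> M"
    and p: "n \<le> p" "s + p \<le> T"
  shows "\<exists>m' M'. m' \<le> M' \<and> (\<forall>i\<in>A. m' \<le> x (s + p) i \<and> x (s + p) i \<le> M') \<and>
    M' - m' \<le> (1 - b ^ p) * (M - m)"
proof -
  \<comment> \<open>Half the spread, shrunk by \<open>b\<close> per iteration: \<open>lifts\<close>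
    with threshold \<open>m + c q\<close> gains \<open>b * c q\<close>, which is
    \<open>c (Suc q)\<close>.\<close>
  define c where "c q = b ^ q * (M - m) / 2" for q
  define hi where "hi q = {i \<in> A. m + c q \<le> x (s + q) i}" for q
  define lo where "lo q = {i \<in> A. x (s + q) i \<le> M - c q}" for q
  have c_nonneg: "0 \<le> c q" for q using b bounds by (simp add: c_def)
  have c_Suc: "c (Suc q) = b * c q" for q by (simp add: c_def)
  have within: "\<forall>i\<in>A. m \<le> x t i \<and> x t i \<le> M" if "s \<le> t" "t \<le> T" for t
    using lifts_lower_bound[OF up, of m s t] lifts_lower_bound[OF down, of "- M" s t] bounds(2) that
    by simp
  have hi_step: "i \<in> hi (Suc q)"
    if "i \<in> A" "s + q < T" "i \<in> hi q \<or> k \<le> card (N i \<inter> hi q)" for i q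
  proof -
    have "N i \<inter> hi q = {j \<in> N i \<inter> A. m + c q \<le> x (s + q) j}"
      unfolding hi_def by auto
    then have "m + b * ((m + c q) - m) \<le> x (Suc (s + q)) i"
      using that up within[of "s + q"] c_nonneg[of q]
      by (intro liftsD[of k b A N "x (s + q)"]) (auto simp: hi_def)
    then show ?thesis using that(1) c_Suc by (simp add: hi_def)
  qed
  have lo_step: "i \<in> lo (Suc q)"
    if "i \<in> A" "s + q < T" "i \<in> lo q \<or> k \<le> card (N i \<inter> lo q)" for i q
  proof -
    have "N i \<inter> lo q = {j \<in> N i \<inter> A. - M + c q \<le> - x (s + q) j}"
      unfolding lo_def by auto
    then have "- M + b * ((- M + c q) - (- M)) \<le> - x (Suc (s + q)) i"
      using that down within[of "s + q"] c_nonneg[of q]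
      by (intro liftsD[of k b A N "\<lambda>i. - x (s + q) i"]) (auto simp: lo_def)
    then show ?thesis using that(1) c_Suc by (simp add: lo_def)
  qed
  \<comment> \<open>The last alternative is the progress measure: while neither group is all of
    \<open>A\<close>, the processes that are not high and those that are not low together become
    fewer in every iteration.\<close>
  have "A = hi q \<union> lo q \<and> (hi q = A \<or> lo q = A \<or> card (A - hi q) + card (A - lo q) + q \<le> card A)"
    if "q \<le> n - 1" for q
    using that
  proof (induction q)
    case 0
    \<comment> \<open>At \<open>q = 0\<close> both thresholds are the midpoint of \<open>m\<close>
      and \<open>M\<close>.\<close>
    have cover: "A = hi 0 \<union> lo 0"
      by (auto simp: hi_def lo_def c_def field_simps)
    then have "card (A - hi 0) + card (A - lo 0) = card ((A - hi 0) \<union> (A - lo 0))"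
      using fin by (subst card_Un_disjoint) auto
    also have "\<dots> \<le> card A" using fin by (intro card_mono) auto
    finally show ?case using cover by simp
  next
    case (Suc q)
    then have T: "s + q < T" using p by simp
    have IH: "A = hi q \<union> lo q"
      "hi q = A \<or> lo q = A \<or> card (A - hi q) + card (A - lo q) + q \<le> card A"
      using Suc by auto
    have sub: "hi q \<subseteq> hi (Suc q)" "lo q \<subseteq> lo (Suc q)" "hi (Suc q) \<subseteq> A" "lo (Suc q) \<subseteq> A"
      using hi_step lo_step T by (auto simp: hi_def lo_def)
    have cover: "A = hi (Suc q) \<union> lo (Suc q)" using IH(1) sub by auto
    show ?case
    proof (cases "hi q = A \<or> lo q = A")
      case True
      then show ?thesis using cover sub by auto
    next
      case False
      then have drop: "card (A - hi q) + card (A - lo q) + q \<le> card A" using IH by auto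
      have fins: "finite (A - hi q)" "finite (A - lo q)" using fin by auto
      have sub': "A - hi (Suc q) \<subseteq> A - hi q" "A - lo (Suc q) \<subseteq> A - lo q" using sub by auto
      have inter: "A \<inter> hi q = hi q" "A \<inter> lo q = lo q" by (auto simp: hi_def lo_def)
      have diffs: "A - (A - hi q) = hi q" "A - (A - lo q) = lo q"
        by (auto simp: hi_def lo_def)
      \<comment> \<open>Condition SC is applied with the non-high processes as \<open>L\<close> and
        the non-low ones as \<open>R\<close>. They are disjoint because every process is high or
        low, and the edges counted come from \<open>hi q\<close> or from
        \<open>lo q\<close>.\<close>
      have "(\<exists>i\<in>A - hi q. k \<le> card (N i \<inter> hi q)) \<or> (\<exists>i\<in>A - lo q. k \<le> card (N i \<inter> lo q))"
        using False IH(1) inter SC[of "A - hi q" "A - lo q"] unfolding diffs by auto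
      then have "(\<exists>i\<in>A - hi q. i \<in> hi (Suc q)) \<or> (\<exists>i\<in>A - lo q. i \<in> lo (Suc q))"
        using hi_step[OF _ T] lo_step[OF _ T] by blast
      then have "A - hi (Suc q) \<subset> A - hi q \<or> A - lo (Suc q) \<subset> A - lo q"
        using sub' by blast
      then have "card (A - hi (Suc q)) + card (A - lo (Suc q)) < card (A - hi q) + card (A - lo q)"
        using psubset_card_mono fins card_mono sub'
        by (metis add_less_le_mono add_le_less_mono)
      then show ?thesis using cover drop by simp
    qed
  qed
  note inv = this
  let ?K = "n - 1"
  \<comment> \<open>Otherwise both complements are non-empty and the measure gives
    \<open>2 + (n - 1) \<le> card A \<le> n\<close>.\<close>
  have "hi ?K = A \<or> lo ?K = A"
  proof (rule ccontr)
    assume neg: "\<not> ?thesis"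
    moreover have "hi ?K \<subseteq> A" "lo ?K \<subseteq> A" by (auto simp: hi_def lo_def)
    ultimately have "card (A - hi ?K) \<ge> 1" "card (A - lo ?K) \<ge> 1"
      using fin by (auto simp: Suc_le_eq card_gt_0_iff)
    moreover have "card (A - hi ?K) + card (A - lo ?K) + ?K \<le> card A"
      using inv[of ?K] neg by blast
    ultimately show False using fin by linarith
  qed
  then have "(\<forall>i\<in>A. m + c ?K \<le> x (s + ?K) i) \<or> (\<forall>i\<in>A. x (s + ?K) i \<le> M - c ?K)"
    unfolding hi_def lo_def by blast
  moreover have K: "s \<le> s + p" "s + ?K \<le> s + p" using p by auto
  \<comment> \<open>The remaining \<open>p - ?K\<close> iterations preserve the improved
    bound.\<close>
  ultimately have "(\<forall>i\<in>A. m + c ?K \<le> x (s + p) i) \<or> (\<forall>i\<in>A. x (s + p) i \<le> M - c ?K)"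
    using lifts_lower_bound[OF up, of "m + c ?K" "s + ?K" "s + p"]
      lifts_lower_bound[OF down, of "- (M - c ?K)" "s + ?K" "s + p"] p(2)
    unfolding neg_le_iff_le by blast
  moreover have "\<forall>i\<in>A. m \<le> x (s + p) i \<and> x (s + p) i \<le> M"
    using within K p by blast
  moreover have "c ?K \<le> M - m"
  proof -
    have "b ^ ?K \<le> 1" using b by (intro power_le_one) auto
    then have "b ^ ?K * (M - m) \<le> 1 * (M - m)"
      using bounds by (intro mult_right_mono) auto
    then show ?thesis using bounds(1) by (simp add: c_def)
  qed
  moreover have "M - m - c ?K \<le> (1 - b ^ p) * (M - m)"
  proof -
    \<comment> \<open>Since \<open>n\<close> exceeds \<open>?K\<close> by one, the extra factor
      \<open>b \<le> 1 / 2\<close> pays for the \<open>1 / 2\<close> in \<open>c\<close>.\<close>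
    have "b ^ p \<le> b ^ n" using b p by (intro power_decreasing) auto
    also have "\<dots> = b ^ ?K * b" using fin by (metis power_minus_mult)
    also have "\<dots> \<le> b ^ ?K * (1 / 2)" using b by (intro mult_left_mono) auto
    finally have "b ^ p * (M - m) \<le> b ^ ?K * (1 / 2) * (M - m)"
      using bounds by (intro mult_right_mono) auto
    also have "\<dots> = c ?K" by (simp add: c_def)
    finally show ?thesis by (simp add: left_diff_distrib)
  qed
  ultimately have
    "m + c ?K \<le> M \<and> (\<forall>i\<in>A. m + c ?K \<le> x (s + p) i \<and> x (s + p) i \<le> M) \<and>
       M - (m + c ?K) \<le> (1 - b ^ p) * (M - m) \<or>
     m \<le> M - c ?K \<and> (\<forall>i\<in>A. m \<le> x (s + p) i \<and> x (s + p) i \<le> M - c ?K) \<and>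
       M - c ?K - m \<le> (1 - b ^ p) * (M - m)"
    by auto
  then show ?thesis by blast
qed

section \<open>In-degrees and the stopping time\<close>

text \<open>Condition SC with \<open>L = {i}\<close> and empty \<open>C\<close>: another process has
  at most one edge from \<open>i\<close>, fewer than \<open>d * f + 1\<close>, so \<open>i\<close>
  has \<open>d * f + 1\<close> in-neighbours outside each admissible \<open>F\<close>. Putting
  \<open>f\<close> in-neighbours into \<open>F\<close> adds \<open>f\<close> to the count.\<close>

lemma condition_SC_in_degree:
  assumes SC: "condition_SC d f n E" and E: "simple_digraph n E" and n: "n \<ge> 2"
    and f: "f > 0" and d: "d > 0" and i: "i \<in> {1..n}"
  shows "(d + 1) * f + 1 \<le> card (in_nbrs E i)"
proof (rule ccontr)
  assume "\<not> ?thesis"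
  then have small: "card (in_nbrs E i) \<le> d * f + f" by simp
  let ?N = "in_nbrs E i"
  have N: "?N \<subseteq> {1..n} - {i}"
    using E by (auto simp: in_nbrs_def simple_digraph_def irrefl_def)
  then have finN: "finite ?N" using finite_subset by blast
  have many_in: "d * f + 1 \<le> card (?N \<inter> ({1..n} - {i} - F))"
    if F: "F \<subset> {1..n} - {i}" "card F \<le> f" for F
  proof -
    let ?R = "{1..n} - {i} - F"
    have "(\<exists>j\<in>{i}. d * f + 1 \<le> card (in_nbrs E j \<inter> (?R \<union> {}))) \<or>
          (\<exists>j\<in>?R. d * f + 1 \<le> card (in_nbrs E j \<inter> ({i} \<union> {})))"
      using SC[unfolded condition_SC_def, rule_format, of F "{i}" "{}" ?R] F i by blast
    moreover have "card (in_nbrs E j \<inter> {i}) \<le> 1" for j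
      using card_mono[of "{i}" "in_nbrs E j \<inter> {i}"] by simp
    moreover have "1 < d * f + 1" using f d by simp
    ultimately show ?thesis by (metis Un_empty_right not_less singletonD le_trans)
  qed
  show False
  proof (cases "f < n - 1")
    case True
    \<comment> \<open>Here \<open>F\<close> cannot exhaust the processes other than
      \<open>i\<close>. The minimum covers an in-degree below \<open>f\<close>, where
      \<open>F\<close> is all of \<open>?N\<close>.\<close>
    obtain F where F: "F \<subseteq> ?N" "card F = min f (card ?N)" "finite F"
      by (meson min.cobounded2 obtain_subset_with_card_n)
    have "card F < card ({1..n} - {i})" using F True i by simp
    then have "F \<subset> {1..n} - {i}" using F N by blast
    moreover have "card F \<le> f" using F by simp
    ultimately have "d * f + 1 \<le> card (?N \<inter> ({1..n} - {i} - F))" by (rule many_in)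
    also have "\<dots> \<le> card (?N - F)" using finN by (intro card_mono) auto
    also have "\<dots> = card ?N - card F" using F by (simp add: card_Diff_subset)
    also have "\<dots> \<le> d * f" using F small by auto
    finally show False by simp
  next
    case False
    have card': "card ({1..n} - {i}) = n - 1" using i by simp
    then have "card ({1..n} - {i}) \<noteq> 0" using n by simp
    then obtain j where j: "j \<in> {1..n} - {i}" by (metis card.empty ex_in_conv)
    \<comment> \<open>There are at most \<open>f\<close> processes besides \<open>i\<close>, so all
      of them except \<open>j\<close> may be put into \<open>F\<close>; \<open>j\<close> alone
      cannot supply \<open>d * f + 1 > 1\<close> edges.\<close>
    let ?F = "{1..n} - {i} - {j}"
    have "card ?F \<le> f" using j card' False n by simp
    moreover have "?F \<subset> {1..n} - {i}" using j by blast
    ultimately have "d * f + 1 \<le> card (?N \<inter> ({1..n} - {i} - ?F))" by (rule many_in[rotated])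
    also have "\<dots> \<le> card {j}" by (intro card_mono) auto
    finally show False using f d by simp
  qed
qed

text \<open>For \<open>F = {}\<close>, removing nothing gives a reduced graph, and finiteness of
  \<open>E\<close> makes the cardinalities and \<open>Max\<close> meaningful. Hence a block of
  \<open>max_reduced d f n E * n\<close> iterations has length at least \<open>n\<close>.\<close>

lemma max_reduced_pos:
  assumes E: "simple_digraph n E" and n: "n > 0"
  shows "max_reduced d f n E > 0"
proof -
  let ?C = "{card (reduced_graphs d f n E F) | F. F \<subset> {1..n} \<and> card F \<le> f}"
  have "finite E" using E finite_subset unfolding simple_digraph_def by blast
  moreover have "reduced_graphs d f n E {} \<subseteq> Pow E"
    by (auto simp: reduced_graphs_def Let_def)
  ultimately have "finite (reduced_graphs d f n E {})"
    by (meson finite_Pow_iff finite_subset)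
  moreover have "E \<inter> (({1..n} - {}) \<times> ({1..n} - {})) \<in> reduced_graphs d f n E {}"
    unfolding reduced_graphs_def Let_def mem_Collect_eq Diff_cancel by (simp add: in_nbrs_def)
  ultimately have "0 < card (reduced_graphs d f n E {})"
    by (auto simp: card_gt_0_iff)
  moreover have "?C \<subseteq> (\<lambda>F. card (reduced_graphs d f n E F)) ` Pow {1..n}" by auto
  then have "finite ?C" by (rule finite_subset) simp
  moreover have "card (reduced_graphs d f n E {}) \<in> ?C" using n by auto
  ultimately show ?thesis
    unfolding max_reduced_def by (metis (no_types, lifting) Max_ge less_le_trans)
qed

lemma t_end_exists:
  assumes "\<epsilon> > 0" "n \<ge> 2" "simple_digraph n E"
  obtains T where "is_t_end d f n E \<epsilon> \<mu> U T"
proof -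
  let ?p = "max_reduced d f n E * n"
  let ?a = "1 - beta d f n ^ ?p"
  have p: "0 < ?p" using max_reduced_pos assms by simp
  have "\<exists>t>0. stop_cond d f n E \<epsilon> \<mu> U t"
  proof (cases "U = 0 \<and> \<mu> = 0")
    case True
    then show ?thesis by (auto simp: stop_cond_def)
  next
    case False
    have b: "0 < beta d f n" "beta d f n \<le> 1 / 2"
      using beta_pos beta_le_half assms by auto
    then have "beta d f n ^ ?p \<le> 1" by (intro power_le_one) auto
    moreover have "0 < beta d f n ^ ?p" using b by simp
    ultimately have "?a < 1" by simp
    moreover have "0 < \<epsilon> / (real n * max \<bar>U\<bar> \<bar>\<mu>\<bar>)"
      using False assms by (auto intro!: divide_pos_pos mult_pos_pos simp: max_def)
    ultimately obtain q where q: "?a ^ q < \<epsilon> / (real n * max \<bar>U\<bar> \<bar>\<mu>\<bar>)"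
      using real_arch_pow_inv by blast
    \<comment> \<open>\<open>Suc q\<close> keeps the number of iterations positive even if
      \<open>q = 0\<close>.\<close>
    have "?a ^ Suc q \<le> ?a ^ q"
      using \<open>?a < 1\<close> \<open>beta d f n ^ ?p \<le> 1\<close> by (intro power_decreasing) auto
    then have "stop_cond d f n E \<epsilon> \<mu> U (Suc q * ?p)"
      using q p unfolding stop_cond_def Let_def
      by (subst nonzero_mult_div_cancel_right) auto
    then show ?thesis using p by (intro exI[of _ "Suc q * ?p"]) simp
  qed
  then show ?thesis
    using that exists_least_iff[of "\<lambda>t. 0 < t \<and> stop_cond d f n E \<epsilon> \<mu> U t"]
    unfolding is_t_end_def by blast
qed

section \<open>Runs up to the common halting time\<close>

lemma is_t_end_unique:
  "is_t_end d f n E \<epsilon> \<mu> U s \<Longrightarrow> is_t_end d f n E \<epsilon> \<mu> U t \<Longrightarrow> s = t"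
  unfolding is_t_end_def by (metis linorder_neqE_nat)

text \<open>The stopping rule depends on the iteration number alone and selects exactly one, so all
  fault-free processes halt together.\<close>

lemma byz_iter_execution_halted_iff:
  assumes ex: "byz_iter_execution f n E \<epsilon> \<mu> U B msg (v :: nat \<Rightarrow> nat \<Rightarrow> real ^ 'd) halted"
    and T: "is_t_end CARD('d) f n E \<epsilon> \<mu> U T" and i: "i \<in> {1..n} - B"
  shows "halted i t \<longleftrightarrow> T \<le> t"
proof (induction t)
  case 0
  then show ?case using ex T i by (auto simp: byz_iter_execution_def is_t_end_def)
next
  case (Suc t)
  have "if halted i t then halted i (Suc t) else halted i (Suc t) \<longleftrightarrow> Suc t = T"
    using ex i T is_t_end_unique[OF T] unfolding byz_iter_execution_def
    by (metis diff_Suc_1 le_add1 plus_1_eq_Suc)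
  then show ?case using Suc by (auto split: if_splits)
qed

text \<open>Before \<open>T\<close> no fault-free process has halted, so each fault-free
  in-neighbour sends its current state; the default zero vector can occur only for faulty
  ones.\<close>

lemma byz_iter_execution_step:
  assumes ex: "byz_iter_execution f n E \<epsilon> \<mu> U B msg (v :: nat \<Rightarrow> nat \<Rightarrow> real ^ 'd) halted"
    and E: "simple_digraph n E"
    and T: "is_t_end CARD('d) f n E \<epsilon> \<mu> U T" "t < T" and i: "i \<in> {1..n} - B"
  obtains rcv where "byz_iter_update f (in_nbrs E i) rcv (v i t) (v i (Suc t))"
    "\<And>j. j \<in> in_nbrs E i - B \<Longrightarrow> rcv j = v j t"
proof -
  let ?rcv = "\<lambda>j. case msg (Suc t) j i of None \<Rightarrow> 0 | Some x \<Rightarrow> x"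
  have active: "(\<forall>k. (j, k) \<in> E \<longrightarrow> msg (Suc t) j k = Some (v j t)) \<and>
      byz_iter_update f (in_nbrs E j)
        (\<lambda>l. case msg (Suc t) l j of None \<Rightarrow> 0 | Some x \<Rightarrow> x) (v j t) (v j (Suc t))"
    if "j \<in> {1..n} - B" for j
    using ex that byz_iter_execution_halted_iff[OF ex T(1) that, of t] T(2)
    unfolding byz_iter_execution_def by (metis diff_Suc_1 le_add1 not_le plus_1_eq_Suc)
  show ?thesis
  proof (rule that[of ?rcv])
    show "byz_iter_update f (in_nbrs E i) ?rcv (v i t) (v i (Suc t))" using active[OF i] by simp
    fix j assume "j \<in> in_nbrs E i - B"
    then have "j \<in> {1..n} - B" "(j, i) \<in> E"
      using E by (auto simp: in_nbrs_def simple_digraph_def)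
    then show "?rcv j = v j t" using active by simp
  qed
qed

lemma byz_iter_execution_frozen:
  assumes ex: "byz_iter_execution f n E \<epsilon> \<mu> U B msg (v :: nat \<Rightarrow> nat \<Rightarrow> real ^ 'd) halted"
    and T: "is_t_end CARD('d) f n E \<epsilon> \<mu> U T" "T \<le> t" and i: "i \<in> {1..n} - B"
  shows "v i t = v i T"
  using T(2)
proof (induction rule: dec_induct)
  case (step t)
  then have "halted i t" using byz_iter_execution_halted_iff[OF ex T(1) i] by simp
  then have "v i (Suc t) = v i t"
    using ex i unfolding byz_iter_execution_def by (metis diff_Suc_1 le_add1 plus_1_eq_Suc)
  then show ?case using step by simp
qed simp

section \<open>Validity, termination and agreement\<close>

theorem theorem2:
  fixes n f :: nat
    and E :: "(nat \<times> nat) set"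
    and \<epsilon> \<mu> U :: real
    and B :: "nat set"
    and msg :: "nat \<Rightarrow> nat \<Rightarrow> nat \<Rightarrow> (real ^ 'd) option"
    and v :: "nat \<Rightarrow> nat \<Rightarrow> real ^ 'd"
    and halted :: "nat \<Rightarrow> nat \<Rightarrow> bool"
  assumes "\<epsilon> > 0" and "\<mu> \<le> U"
    and "n \<ge> 2" and "simple_digraph n E"
    and "condition_SC CARD('d) f n E"
    and "B \<subseteq> {1..n}" and "card B \<le> f"
    and "\<forall>i\<in>{1..n} - B. \<forall>l. \<mu> \<le> v i 0 $ l \<and> v i 0 $ l \<le> U"
    and "byz_iter_execution f n E \<epsilon> \<mu> U B msg v halted"
  shows "termination_cond ({1..n} - B) halted \<and>
         validity_cond ({1..n} - B) v \<and>
         agreement_cond \<epsilon> ({1..n} - B) v halted"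
proof -
  let ?A = "{1..n} - B"
  let ?d = "CARD('d)"
  let ?b = "beta ?d f n"
  let ?p = "max_reduced ?d f n E * n"
  note ex = assms(9) and E = assms(4)
  obtain T where T: "is_t_end ?d f n E \<epsilon> \<mu> U T"
    using t_end_exists assms by blast
  note halted_iff = byz_iter_execution_halted_iff[OF ex T]
  note frozen = byz_iter_execution_frozen[OF ex T]
  have finB: "finite B" using assms(6) finite_subset by blast
  have nbrs: "finite (in_nbrs E i)" "card (in_nbrs E i) < n" "in_nbrs E i \<subseteq> {1..n}"
    if "i \<in> {1..n}" for i
  proof -
    have N: "in_nbrs E i \<subset> {1..n}"
      using E that by (auto simp: in_nbrs_def simple_digraph_def irrefl_def)
    then show "finite (in_nbrs E i)" "in_nbrs E i \<subseteq> {1..n}"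
      using finite_subset by blast+
    show "card (in_nbrs E i) < n" using psubset_card_mono[OF _ N] by simp
  qed

  have "v i t \<in> convex hull ((\<lambda>j. v j 0) ` ?A)" if "i \<in> ?A" "t \<le> T" for i t
    using that
  proof (induction t arbitrary: i)
    case 0
    then show ?case by (intro hull_inc) auto
  next
    case (Suc t)
    have "t < T" using Suc by simp
    from byz_iter_execution_step[OF ex E T this Suc.prems(1)] obtain rcv where
      rcv: "byz_iter_update f (in_nbrs E i) rcv (v i t) (v i (Suc t))"
      "\<And>j. j \<in> in_nbrs E i - B \<Longrightarrow> rcv j = v j t" by blast
    have "i \<in> {1..n}" using Suc by auto
    show ?case
    proof (rule byz_iter_update_in_convex[OF rcv(1) nbrs(1)[OF \<open>i \<in> {1..n}\<close>] finB assms(7)])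
      show "rcv ` (in_nbrs E i - B) \<subseteq> convex hull ((\<lambda>j. v j 0) ` ?A)"
        using Suc rcv(2) nbrs(3)[OF \<open>i \<in> {1..n}\<close>] by auto
    qed (use Suc in auto)
  qed
  then have "validity_cond ?A v"
    unfolding validity_cond_def using frozen by (metis nle_le)
  moreover have "termination_cond ?A halted"
    unfolding termination_cond_def using halted_iff by blast
  moreover have "\<bar>v i T $ l - v j T $ l\<bar> \<le> \<epsilon>" if ij: "i \<in> ?A" "j \<in> ?A" for i j l
  proof -
    define k where "k = ?d * f + 1"
    have lift: "lifts k ?b ?A (in_nbrs E) (\<lambda>i. a \<bullet> v i t) (\<lambda>i. a \<bullet> v i (Suc t))"
      if "t < T" for a t
      unfolding lifts_def
    proof (intro ballI allI impI, elim conjE)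
      fix i m \<theta>
      assume i: "i \<in> ?A" and m: "m \<le> \<theta>" "\<forall>j\<in>?A. m \<le> a \<bullet> v j t"
        and \<theta>: "\<theta> \<le> a \<bullet> v i t \<or> k \<le> card {j \<in> in_nbrs E i \<inter> ?A. \<theta> \<le> a \<bullet> v j t}"
      have i': "i \<in> {1..n}" using i by auto
      from byz_iter_execution_step[OF ex E T that i] obtain rcv where
        rcv: "byz_iter_update f (in_nbrs E i) rcv (v i t) (v i (Suc t))"
        "\<And>j. j \<in> in_nbrs E i - B \<Longrightarrow> rcv j = v j t" by blast
      have "{j \<in> in_nbrs E i \<inter> ?A. \<theta> \<le> a \<bullet> v j t} = {j \<in> in_nbrs E i - B. \<theta> \<le> a \<bullet> rcv j}"
        using rcv(2) nbrs(3)[OF i'] by auto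
      then show "m + ?b * (\<theta> - m) \<le> a \<bullet> v i (Suc t)"
        using \<theta> m i rcv(2) nbrs(3)[OF i'] condition_SC_in_degree[OF assms(5) E assms(3) _ _ i']
        by (intro byz_iter_update_lift[OF rcv(1) nbrs(1)[OF i'] finB assms(7) nbrs(2)[OF i']])
          (auto simp: k_def)
    qed
    define x where "x = (\<lambda>t i. v i t $ l)"
    have up: "\<forall>t<T. lifts k ?b ?A (in_nbrs E) (x t) (x (Suc t))"
      using lift[of _ "axis l 1"] by (simp add: inner_axis' x_def)
    have down: "\<forall>t<T. lifts k ?b ?A (in_nbrs E) (\<lambda>i. - x t i) (\<lambda>i. - x (Suc t) i)"
      using lift[of _ "- axis l 1"] by (simp add: inner_axis' x_def)
    have SC: "(\<exists>i\<in>L. k \<le> card (in_nbrs E i \<inter> (?A - L))) \<or>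
        (\<exists>i\<in>R. k \<le> card (in_nbrs E i \<inter> (?A - R)))"
      if LR: "L \<subseteq> ?A" "R \<subseteq> ?A" "L \<inter> R = {}" "L \<noteq> {}" "R \<noteq> {}" for L R
    proof -
      \<comment> \<open>The actual faulty set \<open>B\<close> serves as \<open>F\<close>, and the
        fault-free processes outside \<open>L\<close> and \<open>R\<close> form the set
        \<open>C\<close>.\<close>
      let ?C = "?A - L - R"
      have eq: "R \<union> ?C = ?A - L" "L \<union> ?C = ?A - R" using LR by auto
      have "B \<union> L \<union> ?C \<union> R = {1..n} \<and> B \<inter> L = {} \<and> B \<inter> ?C = {} \<and> B \<inter> R = {} \<and>
          L \<inter> ?C = {} \<and> L \<inter> R = {} \<and> ?C \<inter> R = {} \<and> L \<noteq> {} \<and> R \<noteq> {} \<and> card B \<le> f"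
        using LR assms(6,7) by blast
      from assms(5)[unfolded condition_SC_def, rule_format, OF this]
      show ?thesis unfolding eq k_def .
    qed
    have p: "n \<le> ?p" using max_reduced_pos[OF E, of ?d f] assms(3) by simp
    have "0 < n" using assms(3) by simp
    note b = beta_pos[OF this, of ?d f] beta_le_half[OF assms(3), of ?d f]
    have cardA: "card ?A \<le> n" using card_mono[of "{1..n}" ?A] by simp
    let ?c = "1 - ?b ^ ?p"
    have c: "0 \<le> ?c" using b by (simp add: power_le_one)
    \<comment> \<open>Each complete block of \<open>?p\<close> iterations shrinks the spread by the
      factor \<open>?c\<close>.\<close>
    have "\<exists>m M. m \<le> M \<and> (\<forall>i\<in>?A. m \<le> x (q * ?p) i \<and> x (q * ?p) i \<le> M) \<and> M - m \<le> ?c ^ q * (U - \<mu>)"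
      if "q * ?p \<le> T" for q
      using that
    proof (induction q)
      case 0
      then show ?case using assms(2,8) by (auto simp: x_def)
    next
      case (Suc q)
      then obtain m M where mM: "m \<le> M" "\<forall>i\<in>?A. m \<le> x (q * ?p) i \<and> x (q * ?p) i \<le> M"
        "M - m \<le> ?c ^ q * (U - \<mu>)" by auto
      have "q * ?p + ?p \<le> T" using Suc.prems by simp
      have "\<exists>m' M'. m' \<le> M' \<and> (\<forall>i\<in>?A. m' \<le> x (q * ?p + ?p) i \<and> x (q * ?p + ?p) i \<le> M') \<and>
          M' - m' \<le> ?c * (M - m)"
        by (rule lifts_spread_contracts[OF _ cardA \<open>0 < n\<close> b up down _ mM(1,2) p \<open>q * ?p + ?p \<le> T\<close>])
          (simp, rule SC)
      then obtain m' M' where m'M': "m' \<le> M'"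
        "\<forall>i\<in>?A. m' \<le> x (q * ?p + ?p) i \<and> x (q * ?p + ?p) i \<le> M'" "M' - m' \<le> ?c * (M - m)"
        by blast
      note m'M'(3)
      also have "?c * (M - m) \<le> ?c * (?c ^ q * (U - \<mu>))" using mM(3) c by (rule mult_left_mono)
      finally have "M' - m' \<le> ?c ^ Suc q * (U - \<mu>)" by (simp only: power_Suc mult.assoc)
      moreover have "Suc q * ?p = q * ?p + ?p" by simp
      ultimately show ?case using m'M'(1,2) by metis
    qed
    from this[of "T div ?p"] obtain m M where
      mM: "\<forall>i\<in>?A. m \<le> x (T div ?p * ?p) i \<and> x (T div ?p * ?p) i \<le> M"
      "M - m \<le> ?c ^ (T div ?p) * (U - \<mu>)" by auto
    \<comment> \<open>The \<open>T mod ?p\<close> iterations after the last complete block cannot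
      widen the interval.\<close>
    have "\<forall>i\<in>?A. m \<le> x T i" "\<forall>i\<in>?A. - M \<le> - x T i"
      using lifts_lower_bound[OF up, of m "T div ?p * ?p" T]
        lifts_lower_bound[OF down, of "- M" "T div ?p * ?p" T] mM(1) by auto
    then have "\<bar>x T i - x T j\<bar> \<le> M - m" using ij by (smt (verit))
    also have "\<dots> \<le> ?c ^ (T div ?p) * (U - \<mu>)" by (rule mM(2))
    also have "\<dots> \<le> \<epsilon>"
    proof (cases "U = 0 \<and> \<mu> = 0")
      case True
      then show ?thesis using assms(1) by simp
    next
      case False
      let ?w = "max \<bar>U\<bar> \<bar>\<mu>\<bar>"
      have w: "0 < ?w" "U - \<mu> \<le> 2 * ?w" using False by auto
      have "?c ^ (T div ?p) \<le> \<epsilon> / (real n * ?w)"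
        using T False unfolding is_t_end_def stop_cond_def Let_def by auto
      \<comment> \<open>\<open>U - \<mu>\<close> may be as large as \<open>2 * ?w\<close>; the
        factor 2 is absorbed by \<open>n \<ge> 2\<close>.\<close>
      then have "?c ^ (T div ?p) * (U - \<mu>) \<le> \<epsilon> / (real n * ?w) * (2 * ?w)"
        using w assms(1,2) by (intro mult_mono) auto
      also have "\<dots> = \<epsilon> * (2 / real n)" using w by simp
      also have "\<dots> \<le> \<epsilon> * 1" using assms(1,3) by (intro mult_left_mono) auto
      finally show ?thesis by simp
    qed
    finally show ?thesis by (simp add: x_def)
  qed
  then have "agreement_cond \<epsilon> ?A v halted"
    unfolding agreement_cond_def using halted_iff frozen by metis
  ultimately show ?thesis by simp
qed

end
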